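(* Let $n\in\mathbb{N}$ and let $G_1,\dots,G_n$ be graphs. Then the following hold. (1) If $\mathrm{Fall}(\biguplus_{i=1}^{n}G_i)\neq\emptyset$, then $\mathrm{Fall}(G_i)\neq\emptyset$ for each $1\leq i\leq n$. (2) $\mathrm{Fall}(\biguplus_{i=1}^{n}G_i)=\bigcap_{i=1}^{n}\mathrm{Fall}(G_i)$. (3) If $\mathrm{Fall}(\biguplus_{i=1}^{n}G_i)\neq\emptyset$, then $\chi_f(\biguplus_{i=1}^{n}G_i)=\min\bigcap_{i=1}^{n}\mathrm{Fall}(G_i)$ and $\psi_f(\biguplus_{i=1}^{n}G_i)=\max\bigcap_{i=1}^{n}\mathrm{Fall}(G_i)$.
   Context: All graphs are finite, simple (undirected, no loops, no multiple edges), with nonempty vertex set. For $k\in\mathbb{N}=\{1,2,\dots\}$ let $[k]=\{1,\dots,k\}$. A (proper) $k$-coloring of a graph $G$ is a function $f:V(G)\to[k]$ such that each $f^{-1}(i)$ is an independent set. It is a fall $k$-coloring if $f(N[v])=[k]$ for every $v\in V(G)$, where $N[v]$ is the closed neighborhood of $v$. $\mathrm{Fall}(G)$ is the set of all positive integers $k$ such that $G$ has a fall $k$-coloring; when it is nonempty, $\chi_f(G)=\min\mathrm{Fall}(G)$ and $\psi_f(G)=\max\mathrm{Fall}(G)$. The union graph $\biguplus_{i=1}^{n}G_i$ is the disjoint union: its vertex set is $\bigcup_{i=1}^{n}(\{i\}\times V(G_i))$ and its edge set is $\bigcup_{i=1}^{n}\{\{(i,x),(i,y)\} : \{x,y\}\in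 E(G_i)\}$. *)

theory Defs
  imports "Graph_Theory.Pair_Digraph"
begin

text \<open>
  A finite simple undirected graph is modelled by the locale predicate \<^const>\<open>pair_graph\<close>:
  \<^term>\<open>pverts G\<close> is finite, \<^term>\<open>parcs G\<close> is a symmetric, loop-free set of pairs of vertices.
  An undirected edge between \<open>x\<close> and \<open>y\<close> is represented by the two pairs \<open>(x, y)\<close> and \<open>(y, x)\<close>.
  \<^const>\<open>pair_graph\<close> admits the null graph, so a nonempty vertex set has to be required separately.
\<close>

definition independent_set :: "'a pair_pre_digraph \<Rightarrow> 'a set \<Rightarrow> bool" where
  "independent_set G S \<longleftrightarrow> S \<subseteq> pverts G \<and> (\<forall>u\<in>S. \<forall>v\<in>S. (u, v) \<notin> parcs G)"

definition closed_neighborhood :: "'a pair_pre_digraph \<Rightarrow> 'a \<Rightarrow> 'a set" where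
  "closed_neighborhood G v = insert v {u \<in> pverts G. (v, u) \<in> parcs G}"

definition proper_coloring :: "'a pair_pre_digraph \<Rightarrow> nat \<Rightarrow> ('a \<Rightarrow> nat) \<Rightarrow> bool" where
  "proper_coloring G k f \<longleftrightarrow>
     f \<in> pverts G \<rightarrow> {1..k} \<and>
     (\<forall>i\<in>{1..k}. independent_set G {v \<in> pverts G. f v = i})"

definition fall_coloring :: "'a pair_pre_digraph \<Rightarrow> nat \<Rightarrow> ('a \<Rightarrow> nat) \<Rightarrow> bool" where
  "fall_coloring G k f \<longleftrightarrow>
     proper_coloring G k f \<and> (\<forall>v\<in>pverts G. f ` closed_neighborhood G v = {1..k})"

definition Fall :: "'a pair_pre_digraph \<Rightarrow> nat set" where
  "Fall G = {k. 1 \<le> k \<and> (\<exists>f. fall_coloring G k f)}"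

text \<open>
  The following two are meaningful only if \<^term>\<open>Fall G \<noteq> {}\<close>; finiteness of \<^term>\<open>Fall G\<close>,
  which \<^const>\<open>Max\<close> presupposes, holds for every graph by \<open>finite_Fall\<close> below.
\<close>

definition chi_f :: "'a pair_pre_digraph \<Rightarrow> nat" where
  "chi_f G = Min (Fall G)"

definition psi_f :: "'a pair_pre_digraph \<Rightarrow> nat" where
  "psi_f G = Max (Fall G)"

definition union_graph :: "nat \<Rightarrow> (nat \<Rightarrow> 'a pair_pre_digraph) \<Rightarrow> (nat \<times> 'a) pair_pre_digraph" where
  "union_graph n G =
     \<lparr> pverts = (\<Union>i\<in>{1..n}. {i} \<times> pverts (G i)),
       parcs = (\<Union>i\<in>{1..n}. {((i, x), (i, y)) | x y. (x, y) \<in> parcs (G i)}) \<rparr>"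

lemma finite_Fall:
  assumes "pair_graph G" and "pverts G \<noteq> {}"
  shows "finite (Fall G)"
proof -
  interpret pair_graph G by (rule assms)
  obtain v where v: "v \<in> pverts G" using assms(2) by blast
  have "k \<le> card (pverts G)" if k: "k \<in> Fall G" for k
  proof -
    obtain f where "f ` closed_neighborhood G v = {1..k}"
      using k v unfolding Fall_def fall_coloring_def by blast
    moreover have "closed_neighborhood G v \<subseteq> pverts G"
      using v by (auto simp: closed_neighborhood_def)
    ultimately have "{1..k} \<subseteq> f ` pverts G" by blast
    then have "card {1..k} \<le> card (pverts G)"
      by (rule surj_card_le[OF pair_finite_verts])
    then show ?thesis by simp
  qed
  then show ?thesis by (meson finite_nat_set_iff_bounded_le)
qed

lemma pair_graph_union_graph:
  assumes G: "\<And>i. i \<in> {1..n} \<Longrightarrow> pair_graph (G i)"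
  shows "pair_graph (union_graph n G)"
proof -
  have wf: "x \<in> pverts (G i)" "y \<in> pverts (G i)" "x \<noteq> y" "(y, x) \<in> parcs (G i)"
    if "i \<in> {1..n}" "(x, y) \<in> parcs (G i)" for i x y
  proof -
    interpret pair_graph "G i" using that by (intro G)
    show "x \<in> pverts (G i)" "y \<in> pverts (G i)"
      using arc_fst_in_verts[OF that(2)] arc_snd_in_verts[OF that(2)] by simp_all
    show "x \<noteq> y" using pair_no_loops[OF that(2)] by simp
    show "(y, x) \<in> parcs (G i)" using that(2) arcs_symmetric by blast
  qed
  have fin: "finite (pverts (union_graph n G))"
    using G by (auto simp: union_graph_def pair_graph_def pair_digraph_def pair_fin_digraph_def
        pair_fin_digraph_axioms_def)
  have sub: "parcs (union_graph n G) \<subseteq> pverts (union_graph n G) \<times> pverts (union_graph n G)"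
    using wf by (fastforce simp: union_graph_def)
  have fin_arcs: "finite (parcs (union_graph n G))"
    using finite_subset[OF sub] fin by simp
  have "sym (parcs (union_graph n G))"
    using wf(4) by (auto simp: union_graph_def sym_def)
  then have symm: "symmetric (with_proj (union_graph n G))"
    by (simp add: symmetric_def)
  show ?thesis
  proof unfold_locales
    fix e assume e: "e \<in> parcs (union_graph n G)"
    show "fst e \<in> pverts (union_graph n G)" "snd e \<in> pverts (union_graph n G)"
      using sub e by auto
    show "fst e \<noteq> snd e"
      using e wf(3) by (auto simp: union_graph_def)
  qed (use fin fin_arcs symm in simp_all)
qed

end

theory Submission
  imports Defs
begin

text \<open>No arc of the disjoint union joins different components, so both properness and the
  condition on closed neighborhoods can be checked one component at a time. Hence \<open>f\<close>
  is a fall \<open>k\<close>-coloring of the union iff each restriction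
  \<open>\<lambda>x. f (i, x)\<close> is one of \<open>G i\<close>
  (\<open>fall_coloring_union_graph_iff\<close>). Restricting and gluing colorings then gives the
  intersection formula \<open>Fall_union_graph\<close>; the claims on nonemptiness,
  \<open>chi_f\<close> and \<open>psi_f\<close> follow by rewriting with it.\<close>

text \<open>Trades color classes for a condition on single arcs, which splits over components; an
  arc inside a class violates it at the color \<open>i = f u\<close>.\<close>

lemma proper_coloring_iff:
  "proper_coloring G k f \<longleftrightarrow>
     f \<in> pverts G \<rightarrow> {1..k} \<and>
     (\<forall>u\<in>pverts G. \<forall>v\<in>pverts G. (u, v) \<in> parcs G \<longrightarrow> f u \<noteq> f v)"
  unfolding proper_coloring_def independent_set_def by (fastforce simp: Pi_iff)

lemma pverts_union_graph_iff:
  "(i, x) \<in> pverts (union_graph n G) \<longleftrightarrow> i \<in> {1..n} \<and> x \<in> pverts (G i)"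
  by (auto simp: union_graph_def)

lemma parcs_union_graph_iff:
  "((i, x), (j, y)) \<in> parcs (union_graph n G) \<longleftrightarrow> i \<in> {1..n} \<and> j = i \<and> (x, y) \<in> parcs (G i)"
  by (auto simp: union_graph_def)

text \<open>Arcs of the union keep the index, so neighbors of \<open>(i, x)\<close> are tagged
  neighbors of \<open>x\<close>. For \<open>i\<close> out of range the left side would be just
  \<open>{(i, x)}\<close>.\<close>

lemma closed_neighborhood_union_graph:
  assumes "i \<in> {1..n}"
  shows "closed_neighborhood (union_graph n G) (i, x) = Pair i ` closed_neighborhood (G i) x"
  using assms unfolding closed_neighborhood_def
  by (auto simp: pverts_union_graph_iff parcs_union_graph_iff)

lemma proper_coloring_union_graph_iff:
  "proper_coloring (union_graph n G) k f \<longleftrightarrow>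
     (\<forall>i\<in>{1..n}. proper_coloring (G i) k (\<lambda>x. f (i, x)))"
  unfolding proper_coloring_iff
  by (simp add: Pi_iff split_paired_all Ball_def
      pverts_union_graph_iff parcs_union_graph_iff) blast

lemma fall_coloring_union_graph_iff:
  "fall_coloring (union_graph n G) k f \<longleftrightarrow>
     (\<forall>i\<in>{1..n}. fall_coloring (G i) k (\<lambda>x. f (i, x)))"
proof -
  have "(\<forall>v\<in>pverts (union_graph n G). f ` closed_neighborhood (union_graph n G) v = {1..k}) \<longleftrightarrow>
    (\<forall>i\<in>{1..n}. \<forall>x\<in>pverts (G i). (\<lambda>x. f (i, x)) ` closed_neighborhood (G i) x = {1..k})"
    by (simp add: Ball_def split_paired_all pverts_union_graph_iff
        closed_neighborhood_union_graph image_image) blast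
  then show ?thesis
    unfolding fall_coloring_def proper_coloring_union_graph_iff by blast
qed

lemma Fall_union_graph:
  assumes "1 \<le> n"
  shows "Fall (union_graph n G) = (\<Inter>i\<in>{1..n}. Fall (G i))"
proof (intro equalityI subsetI)
  fix k assume "k \<in> Fall (union_graph n G)"
  then show "k \<in> (\<Inter>i\<in>{1..n}. Fall (G i))"
    unfolding Fall_def fall_coloring_union_graph_iff by blast
next
  fix k assume k: "k \<in> (\<Inter>i\<in>{1..n}. Fall (G i))"
  then have "\<forall>i\<in>{1..n}. \<exists>f. fall_coloring (G i) k f"
    unfolding Fall_def by blast
  then obtain f where "\<forall>i\<in>{1..n}. fall_coloring (G i) k (f i)"
    by metis
  \<comment> \<open>Gluing: the index of a vertex selects which of the chosen colorings to apply, so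
    each restriction is \<open>f i\<close> again.\<close>
  then have "fall_coloring (union_graph n G) k (\<lambda>(i, x). f i x)"
    by (simp add: fall_coloring_union_graph_iff)
  \<comment> \<open>This is where \<open>1 \<le> n\<close> enters: some component must exist to
    bound \<open>k\<close>, since an empty intersection would be all of \<open>nat\<close>,
    including 0.\<close>
  moreover have "1 \<le> k"
    using k assms unfolding Fall_def by fastforce
  ultimately show "k \<in> Fall (union_graph n G)"
    unfolding Fall_def by blast
qed

theorem theorem9:
  fixes n :: nat and G :: "nat \<Rightarrow> 'a pair_pre_digraph"
  assumes "1 \<le> n"
    and "\<And>i. i \<in> {1..n} \<Longrightarrow> pair_graph (G i)"
    and "\<And>i. i \<in> {1..n} \<Longrightarrow> pverts (G i) \<noteq> {}"
  shows "(Fall (union_graph n G) \<noteq> {} \<longrightarrow> (\<forall>i\<in>{1..n}. Fall (G i) \<noteq> {}))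
    \<and> Fall (union_graph n G) = (\<Inter>i\<in>{1..n}. Fall (G i))
    \<and> (Fall (union_graph n G) \<noteq> {} \<longrightarrow>
         chi_f (union_graph n G) = Min (\<Inter>i\<in>{1..n}. Fall (G i))
       \<and> psi_f (union_graph n G) = Max (\<Inter>i\<in>{1..n}. Fall (G i)))"
  unfolding chi_f_def psi_f_def Fall_union_graph[OF assms(1)] by blast

end
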